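(* Let $\bar x$ be a feasible point for problem (P). Suppose that there exists $$\lambda=(\lambda_0,\lambda_1,\dots,\lambda_p)\in\mathbb{R}^{1+p}$$ with $$\lambda_0 F^{\downarrow}_H(\bar x;u;X)+\sum_{i=1}^p\lambda_i\,(g_i)'_H(\bar x;u;X)>0$$ for all directions $u\in\mathbb{R}^l$. Then $\bar x$ is an isolated local minimizer of problem (P).
   Context: Let $X\subset\mathbb{R}^l$ be a closed set and let $f:\mathbb{R}^l\to\mathbb{R}$, $g_i:\mathbb{R}^l\to\mathbb{R}$ ($i=1,\dots,m$), $h_j:\mathbb{R}^l\to\mathbb{R}$ ($j=1,\dots,q$) be given functions. Problem (P): minimize $f(x)$ subject to $x\in X$, $g_i(x)\le 0$ for $i=1,\dots,m$, $h_j(x)=0$ for $j=1,\dots,q$. A point is feasible if it satisfies all these constraints. For feasible $x$, $I(x)=\{i\in\{1,\dots,m\}: g_i(x)=0\}$, and it is assumed that $I(\bar x)=\{1,2,\dots,p\}$ with $p\le m$. A feasible point $\bar x$ is an isolated local minimizer of (P) if there exist a real $A>0$ and a neighbourhood $N\ni\bar x$ such that $f(x)\ge f(\bar x)+A\|x-\bar x\|$ for all feasible $x\in N$. Notation: $h=h_1^2+\cdots+h_q^2$; for an arbitrary constant $\gamma>0$, the penalty function is $F(x,\gamma)=f(x)+\gamma h(x)+\tfrac12\|x-\bar x\|^2$ (Euclidean norm). Bouligand tangent cone of a set $M\subset\mathbb{R}^l$ at $x\in\mathrm{cl}\,M$: $T(M,x)$ is the set of $u\in\mathbb{R}^l$ for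 which there are $t_k>0$, $t_k\to 0$, and $u_k\to u$ with $x+t_ku_k\in M$ for all $k$. Lower Hadamard conditional derivative of $\varphi$ with respect to $M$ at $x\in M$ in direction $u\in\mathbb{R}^l$: $\varphi^{\downarrow}_H(x;u;M)=\liminf_{(t,u')\to(+0,u),\ x+tu'\in M} t^{-1}(\varphi(x+tu')-\varphi(x))$, with the value $+\infty$ by definition if $u\notin T(M,x)$. If the limit $\varphi'_H(x;u;M)=\lim_{(t,u')\to(+0,u),\ x+tu'\in M} t^{-1}(\varphi(x+tu')-\varphi(x))$ exists, then $\varphi$ is called Hadamard differentiable and $\varphi'_H(x;u;M)$ is its Hadamard derivative at $x$ in direction $u$. $F^{\downarrow}_H(\bar x;u;X)$ denotes the lower Hadamard conditional derivative at $\bar x$ in direction $u$ of the function $x\mapsto F(x,\gamma)$ with respect to $X$ (the constant $\gamma>0$ is suppressed in the notation). Conventions: usual algebraic operations with infinities, and $(\pm\infty)\cdot 0=0\cdot(\pm\infty)=0$.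
   Formalization: The multipliers λ_0,…,λ_p are assumed nonnegative; without a sign condition the claim is false (X=R^l, no active constraints, f(x)=−√|x|, x̄=0, λ_0=−1). Directions are taken with u≠0, since for λ≥0 the strict inequality cannot hold at u=0. *)

theory Defs
  imports "HOL-Analysis.Analysis"
begin

text \<open>Inequality constraints are indexed by \<open>{1..m}\<close> and equality constraints by \<open>{1..q}\<close>;
  the values of \<open>g\<close> and \<open>h\<close> at other indices play no role.\<close>

definition feasible ::
  "(real^'l) set \<Rightarrow> nat \<Rightarrow> (nat \<Rightarrow> real^'l \<Rightarrow> real) \<Rightarrow> nat \<Rightarrow> (nat \<Rightarrow> real^'l \<Rightarrow> real) \<Rightarrow> real^'l \<Rightarrow> bool"
  where "feasible X m g q h x \<longleftrightarrow>
    x \<in> X \<and> (\<forall>i\<in>{1..m}. g i x \<le> 0) \<and> (\<forall>j\<in>{1..q}. h j x = 0)"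

definition active_set :: "nat \<Rightarrow> (nat \<Rightarrow> real^'l \<Rightarrow> real) \<Rightarrow> real^'l \<Rightarrow> nat set"
  where "active_set m g x = {i\<in>{1..m}. g i x = 0}"

definition isolated_local_minimizer ::
  "(real^'l) set \<Rightarrow> (real^'l \<Rightarrow> real) \<Rightarrow> nat \<Rightarrow> (nat \<Rightarrow> real^'l \<Rightarrow> real)
    \<Rightarrow> nat \<Rightarrow> (nat \<Rightarrow> real^'l \<Rightarrow> real) \<Rightarrow> real^'l \<Rightarrow> bool"
  where "isolated_local_minimizer X f m g q h xbar \<longleftrightarrow>
    feasible X m g q h xbar \<and>
    (\<exists>A>0. \<exists>N. open N \<and> xbar \<in> N \<and>
      (\<forall>x\<in>N. feasible X m g q h x \<longrightarrow> f x \<ge> f xbar + A * norm (x - xbar)))"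

definition penalty ::
  "(real^'l \<Rightarrow> real) \<Rightarrow> nat \<Rightarrow> (nat \<Rightarrow> real^'l \<Rightarrow> real) \<Rightarrow> real^'l \<Rightarrow> real \<Rightarrow> real^'l \<Rightarrow> real"
  where "penalty f q h xbar \<gamma> x =
    f x + \<gamma> * (\<Sum>j=1..q. (h j x)\<^sup>2) + 1/2 * (norm (x - xbar))\<^sup>2"

definition tangent_cone :: "(real^'l) set \<Rightarrow> real^'l \<Rightarrow> (real^'l) set"
  where "tangent_cone M x = {u. \<exists>(t :: nat \<Rightarrow> real) (w :: nat \<Rightarrow> real^'l).
    (\<forall>k. t k > 0 \<and> x + t k *\<^sub>R w k \<in> M) \<and> t \<longlonglongrightarrow> 0 \<and> w \<longlonglongrightarrow> u}"

text \<open>The filter of the limit \<open>(t, u') \<longrightarrow> (+0, u)\<close> subject to \<open>x + t u' \<in> M\<close>. The direction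
  \<open>u' = u\<close> is allowed; only \<open>t = 0\<close> is excluded. The filter is trivial
  iff \<open>u\<close> is not in \<open>tangent_cone M x\<close>.\<close>

definition hadamard_filter :: "real^'l \<Rightarrow> real^'l \<Rightarrow> (real^'l) set \<Rightarrow> (real \<times> (real^'l)) filter"
  where "hadamard_filter x u M = at (0, u) within {(t, u'). t > 0 \<and> x + t *\<^sub>R u' \<in> M}"

definition diff_quotient :: "(real^'l \<Rightarrow> real) \<Rightarrow> real^'l \<Rightarrow> real \<times> (real^'l) \<Rightarrow> ereal"
  where "diff_quotient \<phi> x = (\<lambda>(t, u'). ereal ((\<phi> (x + t *\<^sub>R u') - \<phi> x) / t))"

definition lower_hadamard_deriv ::
  "(real^'l \<Rightarrow> real) \<Rightarrow> real^'l \<Rightarrow> real^'l \<Rightarrow> (real^'l) set \<Rightarrow> ereal"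
  where "lower_hadamard_deriv \<phi> x u M =
    (if u \<in> tangent_cone M x then Liminf (hadamard_filter x u M) (diff_quotient \<phi> x) else \<infinity>)"

text \<open>Infinite limits are admitted. In a direction outside the tangent cone
  the limit exists vacuously, and the derivative is given the
  same value \<open>\<infinity>\<close> as the lower derivative.\<close>

definition hadamard_differentiable ::
  "(real^'l \<Rightarrow> real) \<Rightarrow> real^'l \<Rightarrow> real^'l \<Rightarrow> (real^'l) set \<Rightarrow> bool"
  where "hadamard_differentiable \<phi> x u M \<longleftrightarrow>
    (\<exists>d. (diff_quotient \<phi> x \<longlongrightarrow> d) (hadamard_filter x u M))"

definition hadamard_deriv ::
  "(real^'l \<Rightarrow> real) \<Rightarrow> real^'l \<Rightarrow> real^'l \<Rightarrow> (real^'l) set \<Rightarrow> ereal"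
  where "hadamard_deriv \<phi> x u M =
    (if u \<in> tangent_cone M x then Lim (hadamard_filter x u M) (diff_quotient \<phi> x) else \<infinity>)"

end

theory Submission
  imports Defs
begin

text \<open>If \<open>xbar\<close> is not an isolated local minimizer, there are feasible points
  \<open>x n \<longlonglongrightarrow> xbar\<close> with \<open>f (x n) - f xbar < norm (x n - xbar) / (n + 1)\<close>. By compactness of the unit
  sphere their normalized directions accumulate at some \<open>u \<noteq> 0\<close>. Along this sequence
  \<open>h\<close> vanishes, so the difference quotients of the penalty function are bounded above by a null
  sequence, and those of the active \<open>g i\<close> are nonpositive. Hence all derivatives in
  direction \<open>u\<close> are at most 0, contradicting the positivity hypothesis.\<close>

lemma filterlim_hadamard_filter:
  assumes "\<And>n. t n > 0" "\<And>n. x + t n *\<^sub>R w n \<in> M" "t \<longlonglongrightarrow> 0" "w \<longlonglongrightarrow> u"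
  shows "filterlim (\<lambda>n. (t n, w n)) (hadamard_filter x u M) sequentially"
proof -
  have "(\<lambda>n. (t n, w n)) \<longlonglongrightarrow> (0, u)"
    using assms(3,4) by (rule tendsto_Pair)
  moreover have "(t n, w n) \<noteq> (0, u)" for n
    using assms(1)[of n] by auto
  ultimately show ?thesis
    unfolding hadamard_filter_def filterlim_at using assms(1,2) by simp
qed

text \<open>A tangent sequence maps the nontrivial filter \<open>sequentially\<close> into this one.
  Nontriviality is what makes limits along it unique.\<close>

lemma hadamard_filter_neq_bot:
  assumes "u \<in> tangent_cone M x"
  shows "hadamard_filter x u M \<noteq> bot"
proof -
  obtain t w where "\<And>n. t n > 0" "\<And>n. x + t n *\<^sub>R w n \<in> M" "t \<longlonglongrightarrow> (0::real)" "w \<longlonglongrightarrow> u"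
    using assms unfolding tangent_cone_def by blast
  then have "filterlim (\<lambda>n. (t n, w n)) (hadamard_filter x u M) sequentially"
    by (rule filterlim_hadamard_filter)
  then show ?thesis
    by (metis filterlim_def filtermap_bot_iff le_bot trivial_limit_sequentially)
qed

text \<open>In a tangent direction the limit, finite or not, is unique and agrees with the lower
  limit; elsewhere both sides take the default \<infinity>. Thus one upper estimate for lower
  derivatives serves the penalty function and the constraints alike.\<close>

lemma hadamard_deriv_eq_lower_hadamard_deriv:
  assumes "hadamard_differentiable \<phi> x u M"
  shows "hadamard_deriv \<phi> x u M = lower_hadamard_deriv \<phi> x u M"
proof (cases "u \<in> tangent_cone M x")
  case True
  then have nb: "hadamard_filter x u M \<noteq> bot"
    by (rule hadamard_filter_neq_bot)
  obtain d where "(diff_quotient \<phi> x \<longlongrightarrow> d) (hadamard_filter x u M)"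
    using assms unfolding hadamard_differentiable_def by blast
  with True nb show ?thesis
    unfolding hadamard_deriv_def lower_hadamard_deriv_def
    by (simp add: tendsto_Lim lim_imp_Liminf)
qed (simp add: hadamard_deriv_def lower_hadamard_deriv_def)

text \<open>A lower limit over the whole filter cannot exceed what is seen along a single sequence
  running through it.\<close>

lemma lower_hadamard_deriv_le:
  assumes "\<And>n. t n > 0" "\<And>n. x + t n *\<^sub>R w n \<in> M" "t \<longlonglongrightarrow> 0" "w \<longlonglongrightarrow> u"
    and le: "\<And>n. (\<phi> (x + t n *\<^sub>R w n) - \<phi> x) / t n \<le> c n" and "c \<longlonglongrightarrow> C"
  shows "lower_hadamard_deriv \<phi> x u M \<le> ereal C"
proof -
  \<comment> \<open>The sequence itself witnesses tangency, which rules out the default value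
    \<infinity>.\<close>
  have "u \<in> tangent_cone M x"
    unfolding tangent_cone_def using assms(1-4) by blast
  then have eq: "lower_hadamard_deriv \<phi> x u M = Liminf (hadamard_filter x u M) (diff_quotient \<phi> x)"
    by (simp add: lower_hadamard_deriv_def)
  have "y \<le> ereal C" if "y < lower_hadamard_deriv \<phi> x u M" for y
  proof (rule tendsto_lowerbound)
    show "(\<lambda>n. ereal (c n)) \<longlonglongrightarrow> ereal C"
      using \<open>c \<longlonglongrightarrow> C\<close> by simp
    have "\<forall>\<^sub>F z in hadamard_filter x u M. y < diff_quotient \<phi> x z"
      using that le_Liminf_iff unfolding eq by blast
    then have "\<forall>\<^sub>F n in sequentially. y < diff_quotient \<phi> x (t n, w n)"
      by (rule eventually_compose_filterlim) (rule filterlim_hadamard_filter[OF assms(1-4)])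
    then show "\<forall>\<^sub>F n in sequentially. y \<le> ereal (c n)"
    proof eventually_elim
      case (elim n)
      then have "y \<le> ereal ((\<phi> (x + t n *\<^sub>R w n) - \<phi> x) / t n)"
        by (simp add: diff_quotient_def)
      also have "\<dots> \<le> ereal (c n)"
        using le by simp
      finally show ?case .
    qed
  qed simp
  then show ?thesis
    by (rule dense_le)
qed

text \<open>The limit direction stays on the compact unit sphere, so it is nonzero.\<close>

lemma tendsto_imp_convergent_directions:
  fixes x :: "nat \<Rightarrow> 'a::euclidean_space"
  assumes "x \<longlonglongrightarrow> a" "\<And>n. x n \<noteq> a"
  obtains r u where "strict_mono (r :: nat \<Rightarrow> nat)" "u \<noteq> 0"
    "(\<lambda>n. (x (r n) - a) /\<^sub>R norm (x (r n) - a)) \<longlonglongrightarrow> u"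
proof -
  define v where "v n = (x n - a) /\<^sub>R norm (x n - a)" for n
  have "v n \<in> sphere 0 1" for n
    using assms(2)[of n] by (simp add: v_def)
  with compact_sphere obtain u r where "u \<in> sphere 0 1" "strict_mono r" "(v \<circ> r) \<longlonglongrightarrow> u"
    unfolding compact_def by metis
  moreover from this have "u \<noteq> 0"
    by auto
  ultimately show thesis
    using that by (simp add: v_def o_def)
qed

text \<open>Minimality is refuted at each \<open>n\<close> with the same number 1/(n+1) as constant
  \<open>A\<close> and as radius of the neighbourhood. Strictness of the violated inequality forces
  \<open>x n\<close> to differ from \<open>xbar\<close>.\<close>

lemma not_isolated_local_minimizer_sequence:
  assumes "feasible X m g q h xbar" "\<not> isolated_local_minimizer X f m g q h xbar"
  obtains x where "\<And>n. feasible X m g q h (x n)" "\<And>n. x n \<noteq> xbar" "x \<longlonglongrightarrow> xbar"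
    "\<And>n. f (x n) - f xbar < inverse (real (Suc n)) * norm (x n - xbar)"
proof -
  have "\<exists>y. dist xbar y < inverse (real (Suc n)) \<and> feasible X m g q h y \<and>
      f y < f xbar + inverse (real (Suc n)) * norm (y - xbar)" for n
  proof (rule ccontr)
    assume "\<not> ?thesis"
    then have "\<forall>y\<in>ball xbar (inverse (real (Suc n))). feasible X m g q h y \<longrightarrow>
        f y \<ge> f xbar + inverse (real (Suc n)) * norm (y - xbar)"
      by (auto simp: not_less)
    moreover have "inverse (real (Suc n)) > 0"
      by simp
    ultimately show False
      using assms unfolding isolated_local_minimizer_def by (meson centre_in_ball open_ball)
  qed
  then obtain x where x: "\<And>n. dist xbar (x n) < inverse (real (Suc n))"
      "\<And>n. feasible X m g q h (x n)"
      "\<And>n. f (x n) < f xbar + inverse (real (Suc n)) * norm (x n - xbar)"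
    by metis
  have "x n \<noteq> xbar" for n
    using x(3)[of n] by auto
  moreover have "x \<longlonglongrightarrow> xbar"
    by (rule metric_tendsto_imp_tendsto[OF LIMSEQ_inverse_real_of_nat])
      (use less_imp_le[OF x(1)] in \<open>simp add: dist_commute\<close>)
  moreover have "f (x n) - f xbar < inverse (real (Suc n)) * norm (x n - xbar)" for n
    using x(3)[of n] by linarith
  ultimately show thesis
    using that x(2) by blast
qed

theorem theorem4p1:
  fixes X :: "(real^'l) set" and f :: "real^'l \<Rightarrow> real"
    and g h :: "nat \<Rightarrow> real^'l \<Rightarrow> real"
    and m p q :: nat and xbar :: "real^'l" and \<gamma> :: real
  assumes "closed X"
    and "\<gamma> > 0"
    and "feasible X m g q h xbar"
    and "p \<le> m" and "active_set m g xbar = {1..p}"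
    and "\<And>i u. i \<in> {1..p} \<Longrightarrow> u \<noteq> 0 \<Longrightarrow> hadamard_differentiable (g i) xbar u X"
    and "\<exists>lam :: nat \<Rightarrow> real. (\<forall>i\<in>{0..p}. lam i \<ge> 0) \<and>
      (\<forall>u. u \<noteq> 0 \<longrightarrow>
        ereal (lam 0) * lower_hadamard_deriv (penalty f q h xbar \<gamma>) xbar u X
          + (\<Sum>i=1..p. ereal (lam i) * hadamard_deriv (g i) xbar u X) > 0)"
  shows "isolated_local_minimizer X f m g q h xbar"
proof (rule ccontr)
  assume "\<not> isolated_local_minimizer X f m g q h xbar"
  then obtain x where feas: "\<And>n. feasible X m g q h (x n)" and ne: "\<And>n. x n \<noteq> xbar"
    and lim: "x \<longlonglongrightarrow> xbar"
    and less: "\<And>n. f (x n) - f xbar < inverse (real (Suc n)) * norm (x n - xbar)"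
    using not_isolated_local_minimizer_sequence assms(3) by blast
  obtain r u where r: "strict_mono (r :: nat \<Rightarrow> nat)" and "u \<noteq> 0"
    and dir: "(\<lambda>n. (x (r n) - xbar) /\<^sub>R norm (x (r n) - xbar)) \<longlonglongrightarrow> u"
    using tendsto_imp_convergent_directions[OF lim ne] .
  \<comment> \<open>Polar coordinates around \<open>xbar\<close>: step length and unit direction, so
    that \<open>xbar + t n *\<^sub>R w n\<close> is exactly \<open>x (r n)\<close>.\<close>
  define t where "t n = norm (x (r n) - xbar)" for n
  define w where "w n = (x (r n) - xbar) /\<^sub>R t n" for n
  have t_pos: "t n > 0" for n
    using ne by (simp add: t_def)
  have step: "xbar + t n *\<^sub>R w n = x (r n)" for n
    using t_pos[of n] by (simp add: w_def)
  have in_X: "xbar + t n *\<^sub>R w n \<in> X" for n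
    using feas by (simp add: step feasible_def)
  have w_lim: "w \<longlonglongrightarrow> u"
    using dir by (simp add: w_def[abs_def] t_def)
  have "(\<lambda>n. x (r n)) \<longlonglongrightarrow> xbar"
    using LIMSEQ_subseq_LIMSEQ[OF lim r] by (simp add: o_def)
  then have t_lim: "t \<longlonglongrightarrow> 0"
    unfolding t_def[abs_def] using LIM_zero tendsto_norm_zero by blast
  note deriv_le = lower_hadamard_deriv_le[OF t_pos in_X t_lim w_lim, unfolded step]

  have F_le: "lower_hadamard_deriv (penalty f q h xbar \<gamma>) xbar u X \<le> 0"
  proof -
    \<comment> \<open>The first summand bounds the quotient of \<open>f\<close>; the second is the
      quadratic term of the penalty divided by \<open>t n\<close>. The \<gamma> term vanishes at
      both points by feasibility.\<close>
    define c where "c n = inverse (real (Suc (r n))) + t n / 2" for n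
    have "(penalty f q h xbar \<gamma> (x (r n)) - penalty f q h xbar \<gamma> xbar) / t n \<le> c n" for n
    proof -
      have "penalty f q h xbar \<gamma> (x (r n)) - penalty f q h xbar \<gamma> xbar
          = f (x (r n)) - f xbar + 1/2 * (t n)\<^sup>2"
        using feas[of "r n"] assms(3) by (simp add: penalty_def feasible_def t_def)
      also have "\<dots> \<le> c n * t n"
        using less[of "r n"] by (simp add: c_def t_def power2_eq_square algebra_simps)
      finally show ?thesis
        using t_pos[of n] by (simp add: divide_le_eq)
    qed
    moreover have "c \<longlonglongrightarrow> 0"
    proof -
      have "(\<lambda>n. inverse (real (Suc (r n)))) \<longlonglongrightarrow> 0"
        using LIMSEQ_subseq_LIMSEQ[OF LIMSEQ_inverse_real_of_nat r] by (simp add: o_def)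
      from tendsto_add[OF this tendsto_divide_zero[OF t_lim]] show ?thesis
        by (simp add: c_def[abs_def])
    qed
    ultimately show ?thesis
      using deriv_le unfolding zero_ereal_def by blast
  qed

  have g_le: "hadamard_deriv (g i) xbar u X \<le> 0" if i: "i \<in> {1..p}" for i
  proof -
    \<comment> \<open>Activity gives \<open>g i xbar = 0\<close>, so feasibility of
      \<open>x (r n)\<close> fixes the sign of the quotient.\<close>
    have "i \<in> active_set m g xbar"
      using i assms(5) by simp
    then have "g i (x (r n)) \<le> 0" "g i xbar = 0" for n
      using feas[of "r n"] by (auto simp: active_set_def feasible_def)
    then have "(g i (x (r n)) - g i xbar) / t n \<le> 0" for n
      using t_pos[of n] by (simp add: divide_nonpos_pos)
    then have "lower_hadamard_deriv (g i) xbar u X \<le> 0"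
      using deriv_le[of "g i" "\<lambda>_. 0" 0] by (simp add: zero_ereal_def)
    then show ?thesis
      using hadamard_deriv_eq_lower_hadamard_deriv[OF assms(6)[OF i \<open>u \<noteq> 0\<close>]] by simp
  qed

  obtain lam :: "nat \<Rightarrow> real" where lam: "\<forall>i\<in>{0..p}. lam i \<ge> 0"
    and pos: "ereal (lam 0) * lower_hadamard_deriv (penalty f q h xbar \<gamma>) xbar u X
          + (\<Sum>i=1..p. ereal (lam i) * hadamard_deriv (g i) xbar u X) > 0"
    using assms(7) \<open>u \<noteq> 0\<close> by blast
  \<comment> \<open>A derivative may be -\<infinity>, but its product with a zero multiplier is 0.
    All summands are nonpositive, so no sum of opposite infinities arises.\<close>
  have "ereal (lam 0) * lower_hadamard_deriv (penalty f q h xbar \<gamma>) xbar u X \<le> 0"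
    using F_le lam by (auto simp: ereal_mult_le_0_iff)
  moreover have "(\<Sum>i=1..p. ereal (lam i) * hadamard_deriv (g i) xbar u X) \<le> 0"
    using g_le lam by (intro sum_nonpos) (auto simp: ereal_mult_le_0_iff)
  ultimately show False
    using pos add_nonpos_nonpos not_less by blast
qed

end
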